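(* Let $R$ be a unital commutative ring with $2\in R^\times$ and let $q\in R^\times$. In the algebra $\mathrm U(q,R)$, let $a=y-x$ and $b=-xy-q^2z^2$. The collection of all elements $\theta^mz^na^db^p$ for $m,n,p\in\mathbb Z_{\ge0}$ and $d\in\{0,1\}$ is an $R$-basis of $\mathrm U(q,R)$.
   Context: $\mathrm U(q,R)$ is the universal unital associative $R$-algebra generated by elements $\theta,x,y,z$ subject to the relations $qx\theta-q^{-1}\theta x=q\theta y-q^{-1}y\theta=[2]_qz-\theta$, $\quad\theta z-z\theta=y-x$, $qzx-q^{-1}xz=qyz-q^{-1}zy=-z$, $xy+q^2z^2=yx+q^{-2}z^2$, $\quad x+y+(q-q^{-1})(xy+q^2z^2)=0$, where $[2]_q=q+q^{-1}$. *)

theory Defs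
  imports "HOL-Algebra.QuotRing" "HOL-Algebra.Module" "HOL-Library.Poly_Mapping"
begin

text \<open>Words form the free monoid, written additively so that multiplication on
  \<^typ>\<open>'x list \<Rightarrow>\<^sub>0 'r\<close> becomes the convolution product of the free algebra.\<close>

instantiation list :: (type) monoid_add
begin

definition zero_list :: "'a list" where "zero_list = []"

definition plus_list :: "'a list \<Rightarrow> 'a list \<Rightarrow> 'a list" where "plus_list u v = u @ v"

instance
  by standard (simp_all add: zero_list_def plus_list_def)

end

definition type_ring :: "'a::ring_1 ring" where
  "type_ring = \<lparr>carrier = UNIV, mult = (*), one = 1, zero = 0, add = (+)\<rparr>"

abbreviation free_algebra :: "('x list \<Rightarrow>\<^sub>0 'r::comm_ring_1) ring" where
  "free_algebra \<equiv> type_ring"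

definition var :: "'x \<Rightarrow> ('x list \<Rightarrow>\<^sub>0 'r::comm_ring_1)" where
  "var g = Poly_Mapping.single [g] 1"

definition const :: "'r::comm_ring_1 \<Rightarrow> ('x list \<Rightarrow>\<^sub>0 'r)" where
  "const c = Poly_Mapping.single [] c"

definition unit_inv :: "'r::comm_ring_1 \<Rightarrow> 'r" where
  "unit_inv q = (THE r. q * r = 1)"

datatype gen = Theta | X | Y | Z

text \<open>A relation \<open>l = r\<close> is encoded as the element \<open>l - r\<close> of the free algebra.\<close>

definition U_relators :: "'r::comm_ring_1 \<Rightarrow> (gen list \<Rightarrow>\<^sub>0 'r) set" where
  "U_relators q =
    (let \<theta> = var Theta; x = var X; y = var Y; z = var Z; q' = unit_inv q
     in {(const q * x * \<theta> - const q' * \<theta> * x) - (const (q + q') * z - \<theta>),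
         (const q * \<theta> * y - const q' * y * \<theta>) - (const (q + q') * z - \<theta>),
         (\<theta> * z - z * \<theta>) - (y - x),
         (const q * z * x - const q' * x * z) - (- z),
         (const q * y * z - const q' * z * y) - (- z),
         (x * y + const (q ^ 2) * z ^ 2) - (y * x + const (q' ^ 2) * z ^ 2),
         x + y + const (q - q') * (x * y + const (q ^ 2) * z ^ 2)})"

definition U_ideal :: "'r::comm_ring_1 \<Rightarrow> (gen list \<Rightarrow>\<^sub>0 'r) set" where
  "U_ideal q = Idl\<^bsub>free_algebra\<^esub> (U_relators q)"

definition U_class :: "'r::comm_ring_1 \<Rightarrow> (gen list \<Rightarrow>\<^sub>0 'r) \<Rightarrow> (gen list \<Rightarrow>\<^sub>0 'r) set" where
  "U_class q f = U_ideal q +>\<^bsub>free_algebra\<^esub> f"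

text \<open>\<^const>\<open>genideal\<close> is the two-sided ideal generated by a set, so this is the algebra
  presented by the generators and relations. Its scalar action is multiplication by the image of
  the coefficient ring; it is a \<^typ>\<open>('r, 'u) module\<close> record, which also has a product and unit.\<close>

definition U :: "'r::comm_ring_1 \<Rightarrow> ('r, (gen list \<Rightarrow>\<^sub>0 'r) set) module" where
  "U q =
    (let Q = free_algebra Quot U_ideal q
     in \<lparr>carrier = carrier Q, mult = mult Q, one = one Q, zero = zero Q, add = add Q,
         smult = (\<lambda>c u. U_class q (const c) \<otimes>\<^bsub>Q\<^esub> u)\<rparr>)"

definition U_theta where "U_theta q = U_class q (var Theta)"
definition U_x where "U_x q = U_class q (var X)"
definition U_y where "U_y q = U_class q (var Y)"
definition U_z where "U_z q = U_class q (var Z)"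

definition U_a where
  "U_a q = U_y q \<ominus>\<^bsub>U q\<^esub> U_x q"

definition U_b where
  "U_b q = (\<ominus>\<^bsub>U q\<^esub> (U_x q \<otimes>\<^bsub>U q\<^esub> U_y q)) \<ominus>\<^bsub>U q\<^esub> ((q ^ 2) \<odot>\<^bsub>U q\<^esub> (U_z q [^]\<^bsub>U q\<^esub> (2::nat)))"

text \<open>Bases are indexed families, so distinct indices are required to give distinct (indeed
  independent) elements when \<open>R\<close> is nonzero.\<close>

definition lin_independent_family ::
  "('r, 'k) ring_scheme \<Rightarrow> ('r, 'm, 'l) module_scheme \<Rightarrow> 'i set \<Rightarrow> ('i \<Rightarrow> 'm) \<Rightarrow> bool" where
  "lin_independent_family R M I e \<longleftrightarrow>
    (\<forall>J c. finite J \<and> J \<subseteq> I \<and> c \<in> J \<rightarrow> carrier R \<and>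
       (\<Oplus>\<^bsub>M\<^esub> i \<in> J. c i \<odot>\<^bsub>M\<^esub> e i) = \<zero>\<^bsub>M\<^esub> \<longrightarrow> (\<forall>i \<in> J. c i = \<zero>\<^bsub>R\<^esub>))"

definition spanning_family ::
  "('r, 'k) ring_scheme \<Rightarrow> ('r, 'm, 'l) module_scheme \<Rightarrow> 'i set \<Rightarrow> ('i \<Rightarrow> 'm) \<Rightarrow> bool" where
  "spanning_family R M I e \<longleftrightarrow>
    (\<forall>v \<in> carrier M. \<exists>J c. finite J \<and> J \<subseteq> I \<and> c \<in> J \<rightarrow> carrier R \<and>
       v = (\<Oplus>\<^bsub>M\<^esub> i \<in> J. c i \<odot>\<^bsub>M\<^esub> e i))"

definition is_module_basis ::
  "('r, 'k) ring_scheme \<Rightarrow> ('r, 'm, 'l) module_scheme \<Rightarrow> 'i set \<Rightarrow> ('i \<Rightarrow> 'm) \<Rightarrow> bool" where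
  "is_module_basis R M I e \<longleftrightarrow>
    e \<in> I \<rightarrow> carrier M \<and> lin_independent_family R M I e \<and> spanning_family R M I e"


section \<open>The presented algebra is well defined\<close>

lemma type_ring_simps [simp]:
  "carrier type_ring = UNIV" "mult type_ring = (*)" "one type_ring = 1"
  "zero type_ring = 0" "add type_ring = (+)"
  by (simp_all add: type_ring_def)

lemma ring_type_ring: "ring (type_ring :: 'a::ring_1 ring)"
proof (rule ringI)
  show "abelian_group (type_ring :: 'a ring)"
  proof (rule abelian_groupI)
    show "\<exists>y\<in>carrier type_ring. y \<oplus>\<^bsub>type_ring\<^esub> x = \<zero>\<^bsub>type_ring\<^esub>" for x :: 'a
      by (rule bexI[of _ "- x"]) simp_all
  qed (simp_all add: algebra_simps)
  show "Group.monoid (type_ring :: 'a ring)"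
    by (rule monoidI) (simp_all add: algebra_simps)
qed (simp_all add: algebra_simps)

lemma cring_type_ring: "cring (type_ring :: 'a::comm_ring_1 ring)"
  by (rule cring.intro[OF ring_type_ring], unfold_locales)
    (simp_all add: ac_simps)

lemma ideal_U_ideal: "ideal (U_ideal q) free_algebra"
  unfolding U_ideal_def by (rule ring.genideal_ideal[OF ring_type_ring]) simp

lemma U_sel:
  "carrier (U q) = carrier (free_algebra Quot U_ideal q)"
  "mult (U q) = mult (free_algebra Quot U_ideal q)"
  "one (U q) = one (free_algebra Quot U_ideal q)"
  "zero (U q) = zero (free_algebra Quot U_ideal q)"
  "add (U q) = add (free_algebra Quot U_ideal q)"
  "c \<odot>\<^bsub>U q\<^esub> u = U_class q (const c) \<otimes>\<^bsub>U q\<^esub> u"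
  by (simp_all add: U_def Let_def)

lemma ring_U: "ring (U q)"
proof -
  interpret Q: ring "free_algebra Quot U_ideal q"
    by (rule ideal.quotient_is_ring[OF ideal_U_ideal])
  show ?thesis
  proof (rule ringI, unfold U_sel(1-5))
    show "abelian_group (U q)"
    proof (rule abelian_groupI, unfold U_sel(1-5))
      fix u assume "u \<in> carrier (free_algebra Quot U_ideal q)"
      then show "\<exists>v\<in>carrier (free_algebra Quot U_ideal q).
          v \<oplus>\<^bsub>free_algebra Quot U_ideal q\<^esub> u = \<zero>\<^bsub>free_algebra Quot U_ideal q\<^esub>"
        using Q.l_neg Q.a_inv_closed by blast
    qed (fact Q.a_closed Q.zero_closed Q.a_assoc Q.a_comm Q.l_zero)+
    show "Group.monoid (U q)"
      by (rule monoidI, unfold U_sel(1-5))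
        (fact Q.m_closed Q.one_closed Q.m_assoc Q.l_one Q.r_one)+
  qed (fact Q.l_distr Q.r_distr)+
qed

lemma U_class_hom: "U_class q \<in> ring_hom free_algebra (U q)"
  using ideal.rcos_ring_hom[OF ideal_U_ideal, of q]
  by (simp add: ring_hom_def U_sel U_class_def[abs_def])

lemma const_simps:
  "const 1 = 1" "const (c + d) = const c + const d" "const (c * d) = const c * const d"
  by (simp_all add: const_def single_add mult_single plus_list_def zero_list_def flip: single_one)

lemma module_U: "module type_ring (U q)"
proof -
  interpret ring "U q" by (rule ring_U)
  have cl: "U_class q f \<in> carrier (U q)" for f
    using ring_hom_closed[OF U_class_hom] by simp
  show ?thesis
    using ring_hom_one[OF U_class_hom, of q] ring_hom_add[OF U_class_hom, of _ _ q]
      ring_hom_mult[OF U_class_hom, of _ _ q]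
    by (intro moduleI cring_type_ring is_abelian_group)
      (simp_all add: U_sel(6) cl const_simps l_distr r_distr m_assoc)
qed

lemma U_relator_eq_zero:
  assumes "f \<in> U_relators q" shows "U_class q f = \<zero>\<^bsub>U q\<^esub>"
proof -
  interpret ideal "U_ideal q" free_algebra by (rule ideal_U_ideal)
  have "f \<in> U_ideal q"
    using ring.genideal_self[OF ring_type_ring, of "U_relators q"] assms
    by (auto simp: U_ideal_def)
  then show ?thesis
    by (simp add: U_class_def U_sel FactRing_def a_rcos_const)
qed

end

theory Submission
  imports Defs "HOL-Library.Product_Lexorder"
    "HOL-Computational_Algebra.Formal_Power_Series" "HOL-Computational_Algebra.Polynomial"
begin

text \<open>
  Write \<open>p\<close> for the inverse of \<open>q\<close> and \<open>k = q - p\<close>.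

  \<^bold>\<open>Spanning.\<close> The relations express \<open>x z\<close>, \<open>y z\<close> as \<open>z\<close> times a combination of \<open>x\<close>, \<open>y\<close>, 1,
  and \<open>g \<theta>\<close> for \<open>g\<close> among \<open>x\<close>, \<open>y\<close>, \<open>z\<close> as \<open>\<theta> g' + g''\<close> with \<open>g'\<close> a combination of
  \<open>x\<close>, \<open>y\<close>, \<open>z\<close>, 1 and \<open>g''\<close> linear in \<open>x\<close>, \<open>y\<close>, \<open>z\<close>. Two inductions, on the power of \<open>z\<close> and
  on the power of \<open>\<theta>\<close>, therefore reduce the stability of the span under left multiplication by the
  generators to the products \<open>a u\<close> and \<open>b u\<close> with \<open>u = a\<^sup>d b\<^sup>j\<close>; here 2 has to be invertible in
  order to recover \<open>x\<close> and \<open>y\<close> from \<open>a\<close> and \<open>x + y = k b\<close>. These products are settled by the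
  formulas for \<open>a\<^sup>2\<close> and \<open>b a\<close> (\<open>a_squared\<close>, \<open>b_a\<close>).

  \<^bold>\<open>Independence.\<close> The element \<open>c = \<theta> z - y + q b\<close> is central, so that \<open>\<theta>\<close> becomes
  \<open>(c + y - q b) z\<^sup>-\<^sup>1\<close> once \<open>z\<close> is inverted. If \<open>k\<close> were invertible, \<open>x\<close> and \<open>y\<close> could
  be replaced by \<open>1 + k x\<close> and \<open>1 + k y\<close>, which commute with \<open>z\<close> up to powers of \<open>q\<close> and are
  inverse to each other up to adding a multiple of \<open>z\<^sup>2\<close>. Expressed in \<open>x\<close> and \<open>y\<close> themselves this
  leads to a model that makes sense for every \<open>k\<close>: let \<open>\<xi> = X\<close> and
  \<open>\<eta> = - X / (1 + k X)\<close> in the power series ring over \<open>R\<close>, let \<open>z\<close> satisfy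
  \<open>\<xi> z = z (q\<^sup>2 \<xi> + q)\<close> and \<open>\<eta> z = z (p\<^sup>2 \<eta> - p)\<close>, and put \<open>x = \<xi>\<close>,
  \<open>y = \<eta> - q\<^sup>2 k (1 + k \<eta>) z\<^sup>2\<close>. The substitution \<open>X \<mapsto> q\<^sup>2 X + q\<close> is not defined on all power
  series, but only its values on \<open>\<xi>\<close> and \<open>\<eta>\<close> enter, and the model is realised by operators on
  sequences indexed by the powers of \<open>z\<close>. Applied to the unit sequence, the monomial
  \<open>\<theta>\<^sup>m z\<^sup>n a\<^sup>d b\<^sup>j\<close> has the leading term
  \<open>c\<^sup>m z\<^sup>n\<^sup>-\<^sup>m (\<eta> - \<xi>)\<^sup>d (- \<xi> \<eta>)\<^sup>j\<close> (highest in \<open>c\<close>, then lowest in \<open>z\<close>), whose lowest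
  term in \<open>X\<close> is \<open>(- 2)\<^sup>d X\<^sup>d\<^sup>+\<^sup>2\<^sup>j\<close> (\<open>pbw_coeff\<close>). These leading positions are distinct for
  distinct monomials and the coefficients are units.
\<close>

section \<open>Calculating in the free algebra\<close>

lemma poly_mapping_additive_induct [case_names single add]:
  fixes f :: "'a \<Rightarrow>\<^sub>0 'b::comm_monoid_add"
  assumes single: "\<And>w c. P (Poly_Mapping.single w c)"
    and add: "\<And>f g. P f \<Longrightarrow> P g \<Longrightarrow> P (f + g)"
  shows "P f"
proof (induction f rule: update_induct)
  case const
  show ?case using single[of undefined 0] by simp
next
  case (update f a b)
  have "Poly_Mapping.update a b f = Poly_Mapping.single a b + f"
    by (rule poly_mapping_eqI)
      (use update(1) in \<open>auto simp: lookup_update lookup_add lookup_single in_keys_iff when_def\<close>)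
  then show ?case using single[of a b] update(3) by (simp add: add)
qed

lemma const_commute: "f * const c = const c * f"
proof (induction f rule: poly_mapping_additive_induct)
  case (single w d)
  show ?case by (simp add: const_def mult_single plus_list_def mult.commute)
qed (simp add: algebra_simps)

lemma const_minus: "const (- c) = - const c" "const (c - d) = const c - const d"
  by (simp_all add: const_def single_uminus single_diff)

lemma const_power: "const (c ^ n) = const c ^ n"
  by (induction n) (simp_all add: const_simps)

lemma const_0 [simp]: "const 0 = 0"
  by (simp add: const_def)

lemma const_numeral: "const (numeral n) = numeral n"
proof -
  have "const (of_nat m) = of_nat m" for m
    by (induction m) (simp_all add: const_simps)
  from this[of "numeral n"] show ?thesis by simp
qed

lemma U_ideal_closed:
  shows U_ideal_add: "f \<in> U_ideal q \<Longrightarrow> g \<in> U_ideal q \<Longrightarrow> f + g \<in> U_ideal q"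
    and U_ideal_lmult: "f \<in> U_ideal q \<Longrightarrow> h * f \<in> U_ideal q"
    and U_ideal_rmult: "f \<in> U_ideal q \<Longrightarrow> f * h \<in> U_ideal q"
proof -
  interpret ideal "U_ideal q" free_algebra by (rule ideal_U_ideal)
  show "f \<in> U_ideal q \<Longrightarrow> g \<in> U_ideal q \<Longrightarrow> f + g \<in> U_ideal q"
    using additive_subgroup.a_closed[OF ideal.axioms(1)[OF ideal_U_ideal], of f q g] by simp
  show "f \<in> U_ideal q \<Longrightarrow> h * f \<in> U_ideal q" "f \<in> U_ideal q \<Longrightarrow> f * h \<in> U_ideal q"
    using I_l_closed[of f h] I_r_closed[of f h] by simp_all
qed

lemma U_ideal_uminus: "f \<in> U_ideal q \<Longrightarrow> - f \<in> U_ideal q"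
  using U_ideal_lmult[of f q "- 1"] by simp

lemma U_ideal_diff: "f \<in> U_ideal q \<Longrightarrow> g \<in> U_ideal q \<Longrightarrow> f - g \<in> U_ideal q"
  using U_ideal_add[OF _ U_ideal_uminus] by fastforce

lemma U_relator_in_U_ideal: "f \<in> U_relators q \<Longrightarrow> f \<in> U_ideal q"
  using ring.genideal_self[OF ring_type_ring, of "U_relators q"] by (auto simp: U_ideal_def)

section \<open>Spanning modulo the relations\<close>

text \<open>Linear combinations of \<open>G\<close> up to the ideal of relations. Working with such
  sets inside the free algebra, rather than in the quotient, keeps all calculations in a ring type.\<close>

inductive_set mod_span ::
  "'r::comm_ring_1 \<Rightarrow> (gen list \<Rightarrow>\<^sub>0 'r) set \<Rightarrow> (gen list \<Rightarrow>\<^sub>0 'r) set"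
  for q G where
    ideal: "f \<in> U_ideal q \<Longrightarrow> f \<in> mod_span q G"
  | scaled: "g \<in> G \<Longrightarrow> const c * g \<in> mod_span q G"
  | add: "f \<in> mod_span q G \<Longrightarrow> g \<in> mod_span q G \<Longrightarrow> f + g \<in> mod_span q G"

lemma mod_span_base: "g \<in> G \<Longrightarrow> g \<in> mod_span q G"
  using mod_span.scaled[of g G 1 q] by (simp add: const_simps)

lemma mod_span_scale: "f \<in> mod_span q G \<Longrightarrow> const c * f \<in> mod_span q G"
proof (induction rule: mod_span.induct)
  case (scaled g d)
  then show ?case
    using mod_span.scaled[of g G "c * d" q] by (simp add: const_simps mult.assoc)
qed (auto simp: distrib_left intro: mod_span.intros U_ideal_lmult)

text \<open>Since the span is closed under scalars, closure under left multiplication by \<open>h\<close>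
  only has to be tested on the spanning set; all closure properties below are obtained this way.\<close>

lemma mod_span_lmult:
  assumes "\<And>g. g \<in> G \<Longrightarrow> h * g \<in> mod_span q H" and "f \<in> mod_span q G"
  shows "h * f \<in> mod_span q H"
  using assms(2)
proof induction
  case (scaled g c)
  have "h * (const c * g) = const c * (h * g)"
    by (metis const_commute mult.assoc)
  then show ?case using assms(1)[OF scaled] by (simp add: mod_span_scale)
qed (auto simp: distrib_left intro: mod_span.intros U_ideal_lmult)

lemma mod_span_diff: "f \<in> mod_span q G \<Longrightarrow> g \<in> mod_span q G \<Longrightarrow> f - g \<in> mod_span q G"
  using mod_span.add[of f q G "- g"] mod_span_scale[of g q G "- 1"]
  by (simp add: const_minus const_simps)

lemma mod_span_cong: "f - g \<in> U_ideal q \<Longrightarrow> g \<in> mod_span q G \<Longrightarrow> f \<in> mod_span q G"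
  using mod_span.add[OF mod_span.ideal, of "f - g" q g] by simp

lemma mod_span_finite_combination:
  fixes e :: "'i \<Rightarrow> gen list \<Rightarrow>\<^sub>0 'r::comm_ring_1"
  assumes "f \<in> mod_span q (e ` B)"
  shows "\<exists>J c. finite J \<and> J \<subseteq> B \<and> f - (\<Sum>i\<in>J. const (c i) * e i) \<in> U_ideal q"
  using assms
proof induction
  case (ideal f)
  then show ?case by (intro exI[of _ "{}"]) simp
next
  case (scaled g c)
  then obtain i where "i \<in> B" "g = e i" by auto
  then show ?case
    using U_ideal_diff[of 0 q 0] mod_span.ideal
      additive_subgroup.zero_closed[OF ideal.axioms(1)[OF ideal_U_ideal, of q]]
    by (intro exI[of _ "{i}"] exI[of _ "\<lambda>_. c"]) simp
next
  case (add f g)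
  then obtain J c K d where *:
    "finite J" "J \<subseteq> B" "f - (\<Sum>i\<in>J. const (c i) * e i) \<in> U_ideal q"
    "finite K" "K \<subseteq> B" "g - (\<Sum>i\<in>K. const (d i) * e i) \<in> U_ideal q" by blast
  let ?c = "\<lambda>i. if i \<in> J then c i else 0" and ?d = "\<lambda>i. if i \<in> K then d i else 0"
  have "(\<Sum>i\<in>J \<union> K. const (?c i) * e i) = (\<Sum>i\<in>J. const (c i) * e i)"
    using * by (intro sum.mono_neutral_cong_right) auto
  moreover have "(\<Sum>i\<in>J \<union> K. const (?d i) * e i) = (\<Sum>i\<in>K. const (d i) * e i)"
    using * by (intro sum.mono_neutral_cong_right) auto
  ultimately have "f + g - (\<Sum>i\<in>J \<union> K. const (?c i + ?d i) * e i)
      = (f - (\<Sum>i\<in>J. const (c i) * e i)) + (g - (\<Sum>i\<in>K. const (d i) * e i))"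
    by (simp only: const_simps(2) distrib_right sum.distrib) simp
  then have "f + g - (\<Sum>i\<in>J \<union> K. const (?c i + ?d i) * e i) \<in> U_ideal q"
    by (rule ssubst) (rule U_ideal_add[OF *(3,6)])
  moreover have "finite (J \<union> K)" "J \<union> K \<subseteq> B" using * by auto
  ultimately show ?case
    by (intro exI[of _ "J \<union> K"] exI[of _ "\<lambda>i. ?c i + ?d i"] conjI)
qed

section \<open>The defining relations as rewriting rules\<close>

locale unit_pair =
  fixes q p :: "'r::comm_ring_1"
  assumes qp: "q * p = 1"
begin

lemma pq: "p * q = 1"
  using qp by (simp add: mult.commute)

lemma unit_inv_q: "unit_inv q = p"
  unfolding unit_inv_def
proof (rule the_equality)
  fix r assume "q * r = 1"
  then show "r = p" by (metis mult.assoc mult.commute mult_1 qp)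
qed (rule qp)

abbreviation "th \<equiv> (var Theta :: gen list \<Rightarrow>\<^sub>0 'r)"
abbreviation "x \<equiv> (var X :: gen list \<Rightarrow>\<^sub>0 'r)"
abbreviation "y \<equiv> (var Y :: gen list \<Rightarrow>\<^sub>0 'r)"
abbreviation "z \<equiv> (var Z :: gen list \<Rightarrow>\<^sub>0 'r)"

definition "a = y - x"
definition "b = - (x * y) - const (q ^ 2) * z ^ 2"

abbreviation (input) "I \<equiv> U_ideal q"

lemma relations:
  shows rel_x_theta: "const q * x * th - const p * th * x - (const (q + p) * z - th) \<in> I"
    and rel_y_theta: "const q * th * y - const p * y * th - (const (q + p) * z - th) \<in> I"
    and rel_theta_z: "th * z - z * th - (y - x) \<in> I"
    and rel_z_x: "const q * z * x - const p * x * z + z \<in> I"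
    and rel_y_z: "const q * y * z - const p * z * y + z \<in> I"
    and rel_x_y: "x * y + const (q ^ 2) * z ^ 2 - (y * x + const (p ^ 2) * z ^ 2) \<in> I"
    and rel_sum: "x + y + const (q - p) * (x * y + const (q ^ 2) * z ^ 2) \<in> I"
  by (rule U_relator_in_U_ideal; simp add: U_relators_def Let_def unit_inv_q)+

lemma const_qp: "const q * const p = 1" "const p * const q = 1"
   "const q * (const p * f) = f" "const p * (const q * f) = f"
proof -
  show 1: "const q * const p = 1" "const p * const q = 1"
    by (simp_all only: qp pq const_simps(1) flip: const_simps(3))
  show "const q * (const p * f) = f" "const p * (const q * f) = f"
    by (simp_all only: 1 mult_1 flip: mult.assoc)
qed

lemma var_const_left: "var g * (const c * f) = const c * (var g * f)"
  by (metis const_commute mult.assoc)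

lemmas free_simps = const_simps const_minus const_power power2_eq_square algebra_simps
  const_commute[of "var g" for g] var_const_left

text \<open>The next lemmas solve the relations for the products \<open>g z\<close> and \<open>g \<theta>\<close> with
  \<open>g\<close> among \<open>x\<close>, \<open>y\<close>, \<open>z\<close>. What matters is that the right-hand sides are again linear in
  \<open>x\<close>, \<open>y\<close>, \<open>z\<close> once the leading \<open>z\<close> or \<open>\<theta>\<close> is split off on the left. Each proof
  exhibits the difference of both sides as an explicit combination of relators.\<close>

lemma x_z: "x * z - (const (q ^ 2) * z * x + const q * z) \<in> I"
proof -
  have "x * z - (const (q ^ 2) * z * x + const q * z)
      = - (const q * (const q * z * x - const p * x * z + z))"
    by (simp add: free_simps const_qp)
  then show ?thesis by (simp only: U_ideal_uminus U_ideal_lmult rel_z_x)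
qed

lemma y_z: "y * z - (const (p ^ 2) * z * y - const p * z) \<in> I"
proof -
  have "y * z - (const (p ^ 2) * z * y - const p * z)
      = const p * (const q * y * z - const p * z * y + z)"
    by (simp add: free_simps const_qp)
  then show ?thesis by (simp only: U_ideal_lmult rel_y_z)
qed

lemma x_theta: "x * th - (const (p ^ 2) * th * x + const p * const (q + p) * z - const p * th) \<in> I"
proof -
  have "x * th - (const (p ^ 2) * th * x + const p * const (q + p) * z - const p * th)
      = const p * (const q * x * th - const p * th * x - (const (q + p) * z - th))"
    by (simp add: free_simps const_qp)
  then show ?thesis by (simp only: U_ideal_lmult rel_x_theta)
qed

lemma y_theta: "y * th - (const (q ^ 2) * th * y - const q * const (q + p) * z + const q * th) \<in> I"
proof -
  have "y * th - (const (q ^ 2) * th * y - const q * const (q + p) * z + const q * th)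
      = - (const q * (const q * th * y - const p * y * th - (const (q + p) * z - th)))"
    by (simp add: free_simps const_qp)
  then show ?thesis by (simp only: U_ideal_uminus U_ideal_lmult rel_y_theta)
qed

lemma z_theta: "z * th - (th * z + x - y) \<in> I"
  using U_ideal_uminus[OF rel_theta_z] by (simp add: algebra_simps)

lemma sum_eq: "x + y - const (q - p) * b \<in> I"
proof -
  have "x + y - const (q - p) * b = x + y + const (q - p) * (x * y + const (q ^ 2) * z ^ 2)"
    by (simp add: b_def algebra_simps)
  then show ?thesis by (simp only: rel_sum)
qed

text \<open>Modulo the relations \<open>x + y = (q - p) b\<close>, \<open>x y = - b - q\<^sup>2 z\<^sup>2\<close> and
  \<open>y x = - b - p\<^sup>2 z\<^sup>2\<close>; the formula is \<open>(y - x)\<^sup>2 = (x + y)\<^sup>2 - 2 (x y + y x)\<close>.\<close>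

lemma a_squared:
  "a * a - (const ((q - p) ^ 2) * (b * b) + const 4 * b + const (2 * (q ^ 2 + p ^ 2)) * (z * z)) \<in> I"
proof -
  let ?k = "const (q - p)" and ?r = "x * y + const (q ^ 2) * z ^ 2 - (y * x + const (p ^ 2) * z ^ 2)"
  have four: "const 4 * f = f + f + (f + f)" for f :: "gen list \<Rightarrow>\<^sub>0 'r"
  proof -
    have "const 4 * f = const (1 + 1 + (1 + 1)) * f" by simp
    then show ?thesis by (simp only: const_simps distrib_right mult_1)
  qed
  have two: "const (2 * c) * f = const c * f + const c * f" for c and f :: "gen list \<Rightarrow>\<^sub>0 'r"
    by (simp only: mult_2 const_simps distrib_right)
  have k2: "const ((q - p) ^ 2) * (b * b) = ?k * b * (?k * b)"
  proof -
    have "?k * b * (?k * b) = ?k * (b * ?k) * b" by (simp only: mult.assoc)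
    then show ?thesis by (simp only: const_commute[of b] const_simps(3) power2_eq_square mult.assoc)
  qed
  have "a * a - (KB + (B + B + (B + B)) + ((Q2 + P2) * Z + (Q2 + P2) * Z))
    = ((x + y) * (x + y) - KB) + (x * y + Q2 * Z - (y * x + P2 * Z)) + (x * y + Q2 * Z - (y * x + P2 * Z))"
    if "B = - (x * y) - Q2 * Z" for KB B Q2 P2 Z
    unfolding that a_def by (simp add: algebra_simps)
  from this[OF b_def, of "?k * b * (?k * b)" "const (p ^ 2)"]
  have "a * a - (const ((q - p) ^ 2) * (b * b) + const 4 * b + const (2 * (q ^ 2 + p ^ 2)) * (z * z))
    = ((x + y) * (x + y) - ?k * b * (?k * b)) + ?r + ?r"
    unfolding k2 four two const_simps(2) power2_eq_square[of z] by (simp only: add.assoc)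
  moreover have "(x + y) * (x + y) - K * K = (x + y) * (x + y - K) + (x + y - K) * K" for K
    by (simp add: algebra_simps)
  from this[of "?k * b"]
  have "(x + y) * (x + y) - ?k * b * (?k * b) \<in> I"
    by (simp only: U_ideal_add U_ideal_lmult U_ideal_rmult sum_eq)
  ultimately show ?thesis
    by (simp only: U_ideal_add rel_x_y)
qed

text \<open>In the commutator, \<open>b\<close> is taken as \<open>- x y - q\<^sup>2 z\<^sup>2\<close> before \<open>x\<close> and as
  \<open>- y x - p\<^sup>2 z\<^sup>2\<close> after \<open>x\<close>, so that the terms \<open>x y x\<close> cancel and only the commutation of
  \<open>x\<close> with \<open>z\<^sup>2\<close> is left.\<close>

lemma b_x: "b * x - (x * b + const (q + p) * (z * z)) \<in> I"
proof -
  have "b * x - (x * b + const (q + p) * (z * z))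
    = x * (x * y + const (q ^ 2) * z ^ 2 - (y * x + const (p ^ 2) * z ^ 2))
      - const p * ((const q * z * x - const p * x * z + z) * z)
      - const q * (z * (const q * z * x - const p * x * z + z))"
    by (simp add: b_def free_simps const_qp)
  then show ?thesis
    by (simp only: U_ideal_diff U_ideal_lmult U_ideal_rmult rel_x_y rel_z_x)
qed

text \<open>As \<open>b\<close> commutes with itself, it commutes with \<open>x + y\<close>, so its commutator with
  \<open>a = y - x\<close> is \<open>- 2\<close> times its commutator with \<open>x\<close>.\<close>

lemma b_a: "b * a - (a * b - const (2 * (q + p)) * (z * z)) \<in> I"
proof -
  let ?k = "const (q - p)"
  have "B * (y - x) - ((y - x) * B - 2 * S * Z)
    = B * (x + y - K * B) - (x + y - K * B) * B
      - 2 * (B * x - (x * B + S * Z)) + (B * (K * B) - K * B * B)" for B K S Z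
    by (simp add: algebra_simps mult_2)
  from this[of b "const (q + p)" "z * z" ?k]
  have "b * a - (a * b - const (2 * (q + p)) * (z * z))
    = b * (x + y - ?k * b) - (x + y - ?k * b) * b
      - const 2 * (b * x - (x * b + const (q + p) * (z * z))) + (b * (?k * b) - ?k * b * b)"
    by (simp only: const_numeral const_simps(3) a_def)
  moreover have "b * (?k * b) = ?k * b * b" by (metis const_commute mult.assoc)
  ultimately show ?thesis
    by (simp only: U_ideal_diff U_ideal_lmult U_ideal_rmult sum_eq b_x diff_self add_0_right)
qed

end

section \<open>The monomials span\<close>

locale unit_pair_with_half = unit_pair q p for q p :: "'r::comm_ring_1" +
  fixes h :: 'r
  assumes half: "2 * h = 1"
begin

lemma mod_span_cong_rmult:
  assumes "f - g \<in> I" "g * u \<in> mod_span q G" shows "f * u \<in> mod_span q G"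
  using mod_span_cong[of "f * u" "g * u"] U_ideal_rmult[OF assms(1), of u] assms(2)
  by (simp add: left_diff_distrib)

definition "ab_monomials = {a ^ d * b ^ j | d j. d \<in> {0, 1::nat}}"
definition "zab_monomials = {z ^ n * u | n u. u \<in> ab_monomials}"
definition "theta_zab_monomials = {th ^ m * u | m u. u \<in> zab_monomials}"

abbreviation "zab_span \<equiv> mod_span q zab_monomials"
abbreviation "theta_zab_span \<equiv> mod_span q theta_zab_monomials"

lemma zab_spanI: "d \<in> {0, 1} \<Longrightarrow> z ^ n * (a ^ d * b ^ j) \<in> zab_span"
  by (rule mod_span_base) (unfold zab_monomials_def ab_monomials_def, blast)

text \<open>Left multiplication by \<open>b\<close> or \<open>a\<close> may produce \<open>z\<^sup>2\<close> in front, which is why the result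
  lies in the span of the monomials with \<open>z\<close>.\<close>

lemma b_ab_monomial:
  assumes "u \<in> ab_monomials" shows "b * u \<in> zab_span"
proof -
  obtain d j where u: "u = a ^ d * b ^ j" and d: "d \<in> {0, 1}"
    using assms by (auto simp: ab_monomials_def)
  show ?thesis
  proof (cases "d = 0")
    case True
    then show ?thesis using zab_spanI[of 0 0 "Suc j"] u by simp
  next
    case False
    have "(a * b - const (2 * (q + p)) * (z * z)) * b ^ j
        = z ^ 0 * (a ^ 1 * b ^ Suc j) - const (2 * (q + p)) * (z ^ 2 * (a ^ 0 * b ^ j))"
      by (simp add: left_diff_distrib mult.assoc power2_eq_square)
    also have "\<dots> \<in> zab_span"
      by (intro mod_span_diff mod_span_scale zab_spanI) auto
    finally have "b * a * b ^ j \<in> zab_span" by (rule mod_span_cong_rmult[OF b_a])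
    with False u d show ?thesis by (auto simp: mult.assoc)
  qed
qed

lemma a_ab_monomial:
  assumes "u \<in> ab_monomials" shows "a * u \<in> zab_span"
proof -
  obtain d j where u: "u = a ^ d * b ^ j" and d: "d \<in> {0, 1}"
    using assms by (auto simp: ab_monomials_def)
  show ?thesis
  proof (cases "d = 0")
    case True
    then show ?thesis using zab_spanI[of 1 0 j] u by simp
  next
    case False
    have "(const ((q - p) ^ 2) * (b * b) + const 4 * b + const (2 * (q ^ 2 + p ^ 2)) * (z * z)) * b ^ j
        = const ((q - p) ^ 2) * (z ^ 0 * (a ^ 0 * b ^ (2 + j))) + const 4 * (z ^ 0 * (a ^ 0 * b ^ Suc j))
          + const (2 * (q ^ 2 + p ^ 2)) * (z ^ 2 * (a ^ 0 * b ^ j))"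
      by (simp only: distrib_right mult.assoc power_0 mult_1 power2_eq_square power_add power_Suc)
    also have "\<dots> \<in> zab_span"
      by (intro mod_span.add mod_span_scale zab_spanI) auto
    finally have "a * a * b ^ j \<in> zab_span" by (rule mod_span_cong_rmult[OF a_squared])
    with False u d show ?thesis by (auto simp: mult.assoc)
  qed
qed

text \<open>The generators \<open>x\<close> and \<open>y\<close> are recovered from \<open>a\<close> and \<open>b\<close>, at the price of
  dividing by 2.\<close>

lemma x_eq: "x - const h * (const (q - p) * b - a) \<in> I"
proof -
  have "const h * (x + y - K * b) = (const h * 2) * x - const h * (K * b - (y - x))" for K
    by (simp add: algebra_simps mult_2)
  moreover have "const h * 2 = (1 :: gen list \<Rightarrow>\<^sub>0 'r)"
    using half by (simp add: mult.commute const_simps(1) flip: const_numeral const_simps(3))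
  ultimately show ?thesis
    using U_ideal_lmult[OF sum_eq, of "const h"] by (simp add: a_def)
qed

lemma y_eq: "y - const h * (const (q - p) * b + a) \<in> I"
proof -
  have "const h * (x + y - K * b) = (const h * 2) * y - const h * (K * b + (y - x))" for K
    by (simp add: algebra_simps mult_2)
  moreover have "const h * 2 = (1 :: gen list \<Rightarrow>\<^sub>0 'r)"
    using half by (simp add: mult.commute const_simps(1) flip: const_numeral const_simps(3))
  ultimately show ?thesis
    using U_ideal_lmult[OF sum_eq, of "const h"] by (simp add: a_def)
qed

lemma xy_ab_monomial:
  assumes "u \<in> ab_monomials" shows "x * u \<in> zab_span" "y * u \<in> zab_span"
proof -
  have "const h * (K * B - A) * u = const h * (K * (B * u) - A * u)"
    and "const h * (K * B + A) * u = const h * (K * (B * u) + A * u)" for K A B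
    by (simp_all add: algebra_simps)
  moreover have "const h * (const (q - p) * (b * u) - a * u) \<in> zab_span"
    by (intro mod_span_scale mod_span_diff b_ab_monomial a_ab_monomial assms)
  moreover have "const h * (const (q - p) * (b * u) + a * u) \<in> zab_span"
    by (intro mod_span_scale mod_span.add b_ab_monomial a_ab_monomial assms)
  ultimately have *: "const h * (const (q - p) * b - a) * u \<in> zab_span"
    "const h * (const (q - p) * b + a) * u \<in> zab_span" by metis+
  show "x * u \<in> zab_span" "y * u \<in> zab_span"
    by (rule mod_span_cong_rmult[OF x_eq *(1)], rule mod_span_cong_rmult[OF y_eq *(2)])
qed

lemma z_zab_span: "f \<in> zab_span \<Longrightarrow> z * f \<in> zab_span"
proof (rule mod_span_lmult)
  fix g assume "g \<in> zab_monomials"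
  then obtain n u where "g = z ^ n * u" "u \<in> ab_monomials" by (auto simp: zab_monomials_def)
  then have "z * g = z ^ Suc n * u" by (simp add: mult.assoc)
  with \<open>u \<in> ab_monomials\<close> show "z * g \<in> zab_span"
    by (auto intro!: mod_span_base simp only: zab_monomials_def)
qed

text \<open>Induction on the power of \<open>z\<close>: the rules for \<open>x z\<close> and \<open>y z\<close> move one factor
  \<open>z\<close> to the front and leave \<open>x\<close> or \<open>y\<close> acting on a smaller power.\<close>

lemma xy_zab_span:
  assumes "f \<in> zab_span" shows "x * f \<in> zab_span" "y * f \<in> zab_span"
proof -
  have *: "x * (z ^ n * u) \<in> zab_span \<and> y * (z ^ n * u) \<in> zab_span" if u: "u \<in> ab_monomials" for n u
  proof (induction n)
    case 0
    then show ?case using xy_ab_monomial[OF u] by simp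
  next
    case (Suc n)
    let ?w = "z ^ n * u"
    have w: "?w \<in> zab_span"
      using u by (auto intro!: mod_span_base simp: zab_monomials_def)
    have "const (q ^ 2) * (z * (x * ?w)) + const q * (z * ?w) \<in> zab_span"
         "const (p ^ 2) * (z * (y * ?w)) - const p * (z * ?w) \<in> zab_span"
      using Suc w by (auto intro!: mod_span_diff mod_span.add mod_span_scale z_zab_span)
    then have *: "(const (q ^ 2) * z * x + const q * z) * ?w \<in> zab_span"
        "(const (p ^ 2) * z * y - const p * z) * ?w \<in> zab_span"
      by (simp_all only: mult.assoc left_diff_distrib distrib_right)
    have "x * z * ?w \<in> zab_span" "y * z * ?w \<in> zab_span"
      by (rule mod_span_cong_rmult[OF x_z *(1)], rule mod_span_cong_rmult[OF y_z *(2)])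
    then show ?case by (simp only: power_Suc mult.assoc simp_thms)
  qed
  show "x * f \<in> zab_span" "y * f \<in> zab_span"
    by (rule mod_span_lmult[OF _ assms]; use * in \<open>auto simp: zab_monomials_def\<close>)+
qed

lemma theta_span: "f \<in> theta_zab_span \<Longrightarrow> th * f \<in> theta_zab_span"
proof (rule mod_span_lmult)
  fix g assume "g \<in> theta_zab_monomials"
  then obtain n u where "g = th ^ n * u" "u \<in> zab_monomials" by (auto simp: theta_zab_monomials_def)
  then have "th * g = th ^ Suc n * u" by (simp add: mult.assoc)
  with \<open>u \<in> zab_monomials\<close> show "th * g \<in> theta_zab_span"
    by (auto intro!: mod_span_base simp only: theta_zab_monomials_def)
qed

lemma theta_power_span: "f \<in> zab_span \<Longrightarrow> th ^ m * f \<in> theta_zab_span"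
  by (rule mod_span_lmult[of zab_monomials]) (auto intro!: mod_span_base simp: theta_zab_monomials_def)

text \<open>The same induction on the power of \<open>\<theta>\<close>. The three generators have to be treated
  simultaneously, because each of the rules for \<open>x \<theta>\<close>, \<open>y \<theta>\<close>, \<open>z \<theta>\<close> involves further
  generators.\<close>

lemma xyz_span:
  assumes "f \<in> theta_zab_span"
  shows "x * f \<in> theta_zab_span" "y * f \<in> theta_zab_span" "z * f \<in> theta_zab_span"
proof -
  have *: "x * (th ^ m * u) \<in> theta_zab_span \<and> y * (th ^ m * u) \<in> theta_zab_span
      \<and> z * (th ^ m * u) \<in> theta_zab_span" if u: "u \<in> zab_monomials" for m u
  proof (induction m)
    case 0
    have "u \<in> zab_span" using u by (rule mod_span_base)
    then show ?case
      using xy_zab_span[of u] z_zab_span[of u] theta_power_span[of _ 0] by simp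
  next
    case (Suc m)
    let ?w = "th ^ m * u"
    have w: "?w \<in> theta_zab_span"
      using u by (auto intro!: mod_span_base simp: theta_zab_monomials_def)
    have "const (p ^ 2) * (th * (x * ?w)) + const p * (const (q + p) * (z * ?w)) - const p * (th * ?w)
            \<in> theta_zab_span"
         "const (q ^ 2) * (th * (y * ?w)) - const q * (const (q + p) * (z * ?w)) + const q * (th * ?w)
            \<in> theta_zab_span"
         "th * (z * ?w) + x * ?w - y * ?w \<in> theta_zab_span"
      using Suc w by (auto intro!: mod_span_diff mod_span.add mod_span_scale theta_span)
    then have *:
      "(const (p ^ 2) * th * x + const p * const (q + p) * z - const p * th) * ?w \<in> theta_zab_span"
      "(const (q ^ 2) * th * y - const q * const (q + p) * z + const q * th) * ?w \<in> theta_zab_span"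
      "(th * z + x - y) * ?w \<in> theta_zab_span"
      by (simp_all only: mult.assoc left_diff_distrib distrib_right)
    have "x * th * ?w \<in> theta_zab_span" "y * th * ?w \<in> theta_zab_span" "z * th * ?w \<in> theta_zab_span"
      by (rule mod_span_cong_rmult[OF x_theta *(1)], rule mod_span_cong_rmult[OF y_theta *(2)],
          rule mod_span_cong_rmult[OF z_theta *(3)])
    then show ?case by (simp only: power_Suc mult.assoc simp_thms)
  qed
  show "x * f \<in> theta_zab_span" "y * f \<in> theta_zab_span" "z * f \<in> theta_zab_span"
    by (rule mod_span_lmult[OF _ assms]; use * in \<open>auto simp: theta_zab_monomials_def\<close>)+
qed

text \<open>The span contains 1 and is stable under left multiplication by every generator,
  hence contains every word.\<close>

lemma theta_zab_span_UNIV: "f \<in> theta_zab_span"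
proof (induction f rule: poly_mapping_additive_induct)
  case (single w c)
  have "Poly_Mapping.single w 1 \<in> theta_zab_span"
  proof (induction w)
    case Nil
    have "th ^ 0 * (z ^ 0 * (a ^ 0 * b ^ 0)) \<in> theta_zab_span"
      by (rule theta_power_span, rule zab_spanI) simp
    then show ?case by (simp add: const_simps(1)[unfolded const_def])
  next
    case (Cons g w)
    have "Poly_Mapping.single (g # w) 1 = var g * (Poly_Mapping.single w 1 :: gen list \<Rightarrow>\<^sub>0 'r)"
      by (simp add: var_def mult_single plus_list_def)
    then show ?case
      using Cons xyz_span theta_span by (cases g) auto
  qed
  then have "const c * Poly_Mapping.single w 1 \<in> theta_zab_span" by (rule mod_span_scale)
  then show ?case by (simp add: const_def mult_single plus_list_def)
qed (rule mod_span.add)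

end

definition pbw_monomial :: "'r::comm_ring_1 \<Rightarrow> nat \<times> nat \<times> nat \<times> nat \<Rightarrow> (gen list \<Rightarrow>\<^sub>0 'r)" where
  "pbw_monomial q = (\<lambda>(m, n, d, j). var Theta ^ m * var Z ^ n * (var Y - var X) ^ d
     * (- (var X * var Y) - const (q ^ 2) * var Z ^ 2) ^ j)"

lemma (in unit_pair_with_half) theta_zab_monomials_eq:
  "theta_zab_monomials = pbw_monomial q ` {(m, n, d, j). d \<in> {0, 1}}"
proof -
  have eq: "pbw_monomial q (m, n, d, j) = th ^ m * (z ^ n * (a ^ d * b ^ j))" for m n d j
    by (simp only: pbw_monomial_def a_def b_def prod.case mult.assoc)
  show ?thesis
  proof (intro equalityI subsetI)
    fix g assume "g \<in> theta_zab_monomials"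
    then obtain m n d j where "g = pbw_monomial q (m, n, d, j)" "d \<in> {0, 1}"
      unfolding eq theta_zab_monomials_def zab_monomials_def ab_monomials_def by blast
    then show "g \<in> pbw_monomial q ` {(m, n, d, j). d \<in> {0, 1}}" by blast
  next
    fix g assume "g \<in> pbw_monomial q ` {(m, n, d, j). d \<in> {0, 1}}"
    then obtain m n d j where g: "g = pbw_monomial q (m, n, d, j)" "d \<in> {0, 1}" by blast
    then show "g \<in> theta_zab_monomials"
      unfolding g(1) eq theta_zab_monomials_def zab_monomials_def ab_monomials_def by blast
  qed
qed

lemma (in unit_pair_with_half) pbw_monomials_span:
  "\<exists>J c. finite J \<and> J \<subseteq> {(m, n, d, j). d \<in> {0, 1}}
     \<and> f - (\<Sum>i\<in>J. const (c i) * pbw_monomial q i) \<in> U_ideal q"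
  by (rule mod_span_finite_combination) (rule theta_zab_span_UNIV[unfolded theta_zab_monomials_eq])

section \<open>A representation on sequences\<close>

text \<open>A sequence \<open>v\<close> stands for the formal sum of the \<open>z\<^sup>n v\<^sub>n\<close>, \<open>n\<close> an integer, in a skew
  Laurent ring. The coefficients lie in the polynomial ring, in the central variable \<open>c\<close>, over the
  power series ring in one variable \<open>X\<close>.\<close>

type_synonym 'r seq = "int \<Rightarrow> 'r fps poly"

definition emb :: "'r::comm_ring_1 \<Rightarrow> 'r fps poly" where
  "emb c = [:fps_const c:]"

lemma emb_simps [simp]:
  "emb 0 = 0" "emb 1 = 1" "emb (c + d) = emb c + emb d" "emb (c * d) = emb c * emb d"
  "emb (- c) = - emb c" "emb (c - d) = emb c - emb d"
  by (simp_all add: emb_def mult_ac flip: one_pCons)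

lemma emb_power [simp]: "emb (c ^ n) = emb c ^ n"
  by (induction n) simp_all

lemma coeff_emb_mult: "coeff (emb c * f) m = fps_const c * coeff f m"
  by (simp add: emb_def)

context unit_pair
begin

text \<open>The power series inverse of \<open>1 + (q - p) X\<close>. In the coefficient ring
  \<open>x\<close> and \<open>y\<close> start out as \<open>X\<close> and \<open>- X / (1 + (q - p) X)\<close>, which solve
  \<open>x + y + (q - p) x y = 0\<close>. Power series provide this inverse whether or not \<open>q - p\<close> is a
  unit or even zero.\<close>

definition geom :: "'r fps" where "geom = Abs_fps (\<lambda>i. (- (q - p)) ^ i)"

lemma geom_inverse: "(1 + fps_const (q - p) * fps_X) * geom = 1"
proof (rule fps_ext)
  fix n
  have "(1 + fps_const (q - p) * fps_X) * geom = geom + fps_const (q - p) * (fps_X * geom)"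
    by (simp add: algebra_simps)
  then show "fps_nth ((1 + fps_const (q - p) * fps_X) * geom) n = fps_nth 1 n"
    by (cases n) (simp_all add: geom_def algebra_simps)
qed

text \<open>The rule \<open>\<xi> z = z (q\<^sup>2 \<xi> + q)\<close> gives \<open>\<xi> z\<^sup>n = z\<^sup>n \<xi>\<^sub>n\<close>, where \<open>\<xi>\<^sub>n\<close> is the
  \<open>n\<close>-th iterate of \<open>t \<mapsto> q\<^sup>2 t + q\<close>; negative indices iterate the inverse map.
  Similarly \<open>\<eta> z = z (p\<^sup>2 \<eta> - p)\<close>.\<close>

definition xi :: "int \<Rightarrow> 'r fps" where
  "xi n = (if 0 \<le> n then ((\<lambda>t. fps_const (q ^ 2) * t + fps_const q) ^^ nat n) fps_X
           else ((\<lambda>t. fps_const (p ^ 2) * t - fps_const p) ^^ nat (- n)) fps_X)"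

definition eta :: "int \<Rightarrow> 'r fps" where
  "eta n = (if 0 \<le> n then ((\<lambda>t. fps_const (p ^ 2) * t - fps_const p) ^^ nat n) (- (fps_X * geom))
           else ((\<lambda>t. fps_const (q ^ 2) * t + fps_const q) ^^ nat (- n)) (- (fps_X * geom)))"

end

lemma two_sided_iterate_step:
  fixes f g :: "'a \<Rightarrow> 'a"
  assumes inv: "\<And>t. f (g t) = t"
    and s: "\<And>n. s n = (if 0 \<le> n then (f ^^ nat n) t0 else (g ^^ nat (- n)) t0)"
  shows "s (n + 1) = f (s n)"
proof (cases "0 \<le> n")
  case True
  then have "nat (n + 1) = Suc (nat n)" by simp
  then show ?thesis using True by (simp add: s)
next
  case False
  then have "nat (- n) = Suc (nat (- (n + 1)))" by simp
  then show ?thesis using False by (cases "n = - 1") (auto simp: s inv)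
qed

context unit_pair
begin

lemma q2p2: "q\<^sup>2 * p\<^sup>2 = 1" "p\<^sup>2 * q\<^sup>2 = 1" "q\<^sup>2 * p = q" "p\<^sup>2 * q = p"
proof -
  show "q\<^sup>2 * p\<^sup>2 = 1" "p\<^sup>2 * q\<^sup>2 = 1" by (simp_all add: qp pq flip: power_mult_distrib)
  show "q\<^sup>2 * p = q" "p\<^sup>2 * q = p" by (simp_all add: power2_eq_square mult.assoc qp pq)
qed

lemma step_inverse:
  "fps_const (q\<^sup>2) * (fps_const (p\<^sup>2) * t - fps_const p) + fps_const q = t"
  "fps_const (p\<^sup>2) * (fps_const (q\<^sup>2) * t + fps_const q) - fps_const p = t"
  by (simp_all add: right_diff_distrib distrib_left q2p2 flip: mult.assoc)

lemma xi_Suc: "xi (n + 1) = fps_const (q\<^sup>2) * xi n + fps_const q"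
  by (rule two_sided_iterate_step[OF step_inverse(1) xi_def])

lemma eta_Suc: "eta (n + 1) = fps_const (p\<^sup>2) * eta n - fps_const p"
  by (rule two_sided_iterate_step[OF step_inverse(2) eta_def])

lemma xi_0: "xi 0 = fps_X" and eta_0: "eta 0 = - (fps_X * geom)"
  by (simp_all add: xi_def eta_def)

text \<open>The two substitutions multiply \<open>1 + (q - p) u\<close> by \<open>q\<^sup>2\<close> and
  \<open>1 + (q - p) v\<close> by \<open>p\<^sup>2\<close>, so they preserve the product, whose excess over 1 is \<open>q - p\<close> times
  the expression below. The direct computation avoids cancelling \<open>q - p\<close>.\<close>

lemma xi_eta_step:
  fixes u v :: "'r fps"
  assumes "u' = fps_const (q\<^sup>2) * u + fps_const q" "v' = fps_const (p\<^sup>2) * v - fps_const p"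
  shows "u' + v' + fps_const (q - p) * (u' * v') = u + v + fps_const (q - p) * (u * v)"
proof -
  define Q P where "Q = fps_const q" and "P = fps_const p"
  have QP: "Q * P = 1" and PQ: "P * Q = 1" by (simp_all add: Q_def P_def qp pq)
  have QP': "Q * (P * t) = t" "P * (Q * t) = t" for t
    using QP PQ mult.assoc[of Q P t] mult.assoc[of P Q t] by simp_all
  have *: "u' = Q * (Q * u) + Q" "v' = P * (P * v) - P" "fps_const (q - p) = Q - P"
    using assms by (simp_all add: Q_def P_def power2_eq_square mult.assoc flip: fps_const_mult fps_const_sub)
  show ?thesis
    unfolding * by (simp add: algebra_simps QP QP' PQ)
qed

lemma xi_eta: "xi n + eta n + fps_const (q - p) * (xi n * eta n) = 0"
proof (induction n rule: int_induct[where k = 0])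
  case base
  have "xi 0 + eta 0 + fps_const (q - p) * (xi 0 * eta 0)
    = fps_X * (1 - (1 + fps_const (q - p) * fps_X) * geom)"
    unfolding xi_0 eta_0 by (simp add: algebra_simps)
  then show ?case by (simp only: geom_inverse) simp
next
  case (step1 n)
  then show ?case using xi_eta_step[OF xi_Suc[of n] eta_Suc[of n]] by simp
next
  case (step2 n)
  then show ?case using xi_eta_step[OF xi_Suc[of "n - 1"] eta_Suc[of "n - 1"]] by simp
qed

abbreviation "Q \<equiv> emb q"
abbreviation "P \<equiv> emb p"

definition "\<xi> n = [:xi n:]"
definition "\<eta> n = [:eta n:]"
definition "\<gamma> n = 1 + (Q - P) * \<eta> n"

lemma QP: "Q * P = 1" "P * Q = 1" "Q * (P * t) = t" "P * (Q * t) = t"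
proof -
  show 1: "Q * P = 1" "P * Q = 1" by (simp_all add: qp pq flip: emb_simps)
  show "Q * (P * t) = t" "P * (Q * t) = t" by (simp_all only: 1 mult_1 flip: mult.assoc)
qed

lemma \<xi>_Suc: "\<xi> (n + 1) = Q * (Q * \<xi> n) + Q"
  by (simp add: \<xi>_def xi_Suc emb_def power2_eq_square mult.assoc flip: fps_const_mult)

lemma \<eta>_Suc: "\<eta> (n + 1) = P * (P * \<eta> n) - P"
  by (simp add: \<eta>_def eta_Suc emb_def power2_eq_square mult.assoc flip: fps_const_mult)

lemma \<xi>_pred: "\<xi> (n - 1) = P * (P * \<xi> n) - P"
proof -
  have "\<xi> n = Q * (Q * \<xi> (n - 1)) + Q" using \<xi>_Suc[of "n - 1"] by simp
  then show ?thesis by (simp add: algebra_simps QP)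
qed

lemma \<eta>_pred: "\<eta> (n - 1) = Q * (Q * \<eta> n) + Q"
proof -
  have "\<eta> n = P * (P * \<eta> (n - 1)) - P" using \<eta>_Suc[of "n - 1"] by simp
  show ?thesis unfolding \<open>\<eta> n = _\<close> by (simp add: algebra_simps QP)
qed

lemma \<xi>_\<eta>: "\<xi> n + \<eta> n + (Q - P) * (\<xi> n * \<eta> n) = 0"
proof -
  have "\<xi> n + \<eta> n + (Q - P) * (\<xi> n * \<eta> n) = [:xi n + eta n + fps_const (q - p) * (xi n * eta n):]"
    unfolding emb_simps(6)[symmetric] by (simp add: \<xi>_def \<eta>_def emb_def algebra_simps)
  then show ?thesis by (simp add: xi_eta)
qed

lemma \<gamma>_inverse: "\<gamma> n * (1 + (Q - P) * \<xi> n) = 1"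
proof -
  have "\<gamma> n * (1 + (Q - P) * \<xi> n) = 1 + (Q - P) * (\<xi> n + \<eta> n + (Q - P) * (\<xi> n * \<eta> n))"
    by (simp add: \<gamma>_def algebra_simps)
  then show ?thesis by (simp add: \<xi>_\<eta>)
qed

lemma \<gamma>_pred: "\<gamma> (n - 1) = Q * (Q * \<gamma> n)"
  by (simp add: \<gamma>_def \<eta>_pred algebra_simps QP)

lemma \<gamma>_Suc: "\<gamma> (n + 1) = P * (P * \<gamma> n)"
  unfolding \<gamma>_def \<eta>_Suc by (simp add: algebra_simps QP)

text \<open>The part of \<open>c + y - q b\<close> that preserves the exponent of \<open>z\<close>; the polynomial
  variable \<open>[:0, 1:]\<close> is \<open>c\<close>.\<close>

definition "\<tau> n = [:0, 1:] + \<eta> n + Q * (\<xi> n * \<eta> n)"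

lemma \<tau>_pred: "\<tau> (n - 1) = \<tau> n + \<xi> n - \<eta> n"
  by (simp add: \<tau>_def \<eta>_pred \<xi>_pred algebra_simps QP)

lemma pred_pred:
  "\<xi> (n - 2) = P * (P * \<xi> (n - 1)) - P"
  "\<gamma> (n - 2) = Q * (Q * \<gamma> (n - 1))"
  "\<tau> (n - 2) = \<tau> (n - 1) + \<xi> (n - 1) - \<eta> (n - 1)"
  using \<xi>_pred[of "n - 1"] \<gamma>_pred[of "n - 1"] \<tau>_pred[of "n - 1"] by simp_all

text \<open>The operators realise \<open>x = \<xi>\<close>, \<open>y = \<eta> - q\<^sup>2 (q - p) (1 + (q - p) \<eta>) z\<^sup>2\<close> and
  \<open>\<theta> = (c + y - q b) z\<^sup>-\<^sup>1\<close>, where \<open>z\<close> is the shift and \<open>b = - x y - q\<^sup>2 z\<^sup>2\<close>. The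
  correction to \<open>\<eta>\<close> is forced by \<open>x + y = (q - p) b\<close>. The form of \<open>\<theta>\<close>
  comes from the fact that \<open>\<theta> z - y + q b\<close> is central.\<close>

fun gen_op :: "gen \<Rightarrow> 'r seq \<Rightarrow> 'r seq" where
  "gen_op Theta v n = \<tau> n * v (n + 1) + Q * \<gamma> n * v (n - 1)"
| "gen_op X v n = \<xi> n * v n"
| "gen_op Y v n = \<eta> n * v n - Q * Q * (Q - P) * \<gamma> n * v (n - 2)"
| "gen_op Z v n = v (n - 1)"

text \<open>The seven relations hold coefficientwise: in each case the difference of both sides is
  expanded by the shift of \<open>v\<close>, and every coefficient vanishes by the recursions for \<open>\<xi>\<close>,
  \<open>\<eta>\<close>, \<open>\<gamma>\<close>, \<open>\<tau>\<close> or by the identities \<open>\<xi>_\<eta>\<close> and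
  \<open>\<gamma>_inverse\<close>.\<close>

lemma gen_op_x_theta:
  "Q * gen_op X (gen_op Theta v) n - P * gen_op Theta (gen_op X v) n = (Q + P) * gen_op Z v n - gen_op Theta v n"
proof -
  have 1: "\<tau> n * (Q * \<xi> n - P * \<xi> (n + 1) + 1) = 0"
    unfolding \<xi>_Suc by (simp add: algebra_simps QP)
  have "Q * \<gamma> n * (Q * \<xi> n - P * \<xi> (n - 1) + 1) - (Q + P)
    = (Q + P) * (\<gamma> n * (1 + (Q - P) * \<xi> n) - 1)"
    by (simp add: \<xi>_pred algebra_simps QP)
  then have 2: "Q * \<gamma> n * (Q * \<xi> n - P * \<xi> (n - 1) + 1) - (Q + P) = 0"
    by (simp add: \<gamma>_inverse)
  have "Q * gen_op X (gen_op Theta v) n - P * gen_op Theta (gen_op X v) n - ((Q + P) * gen_op Z v n - gen_op Theta v n)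
    = \<tau> n * (Q * \<xi> n - P * \<xi> (n + 1) + 1) * v (n + 1)
      + (Q * \<gamma> n * (Q * \<xi> n - P * \<xi> (n - 1) + 1) - (Q + P)) * v (n - 1)"
    by (simp add: algebra_simps)
  then show ?thesis by (simp add: 1 2)
qed

lemma gen_op_y_theta:
  "Q * gen_op Theta (gen_op Y v) n - P * gen_op Y (gen_op Theta v) n = (Q + P) * gen_op Z v n - gen_op Theta v n"
proof -
  have 1: "Q * \<eta> (n + 1) - P * \<eta> n + 1 = 0"
    unfolding \<eta>_Suc by (simp add: algebra_simps QP)
  have 2: "\<gamma> n * \<gamma> (n - 2) = Q * Q * \<gamma> n * \<gamma> (n - 1)"
    unfolding pred_pred by (simp add: algebra_simps)
  have "Q * Q * \<gamma> n * \<eta> (n - 1) - Q * (Q * Q * (Q - P)) * \<tau> n * \<gamma> (n + 1)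
      - \<eta> n * \<gamma> n + Q * (Q - P) * \<gamma> n * \<tau> (n - 2) + Q * \<gamma> n - (Q + P)
    = (Q + P) * (\<gamma> n * (1 + (Q - P) * \<xi> n) - 1)"
    unfolding pred_pred \<gamma>_Suc \<tau>_pred \<xi>_pred \<eta>_pred by (simp add: algebra_simps QP)
  then have 3: "Q * Q * \<gamma> n * \<eta> (n - 1) - Q * (Q * Q * (Q - P)) * \<tau> n * \<gamma> (n + 1)
      - \<eta> n * \<gamma> n + Q * (Q - P) * \<gamma> n * \<tau> (n - 2) + Q * \<gamma> n - (Q + P) = 0"
    by (simp add: \<gamma>_inverse)
  have "Q * gen_op Theta (gen_op Y v) n - P * gen_op Y (gen_op Theta v) n - ((Q + P) * gen_op Z v n - gen_op Theta v n)
    = \<tau> n * (Q * \<eta> (n + 1) - P * \<eta> n + 1) * v (n + 1)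
      + (Q * Q * \<gamma> n * \<eta> (n - 1) - Q * (Q * Q * (Q - P)) * \<tau> n * \<gamma> (n + 1)
      - \<eta> n * \<gamma> n + Q * (Q - P) * \<gamma> n * \<tau> (n - 2) + Q * \<gamma> n - (Q + P)) * v (n - 1)
      + Q * Q * (Q - P) * (\<gamma> n * \<gamma> (n - 2) - Q * Q * \<gamma> n * \<gamma> (n - 1)) * v (n - 3)"
    by (simp add: algebra_simps QP)
  then show ?thesis by (simp only: 1 2 3) simp
qed

lemma gen_op_theta_z: "gen_op Theta (gen_op Z v) n - gen_op Z (gen_op Theta v) n = gen_op Y v n - gen_op X v n"
  by (simp add: \<tau>_pred \<gamma>_pred algebra_simps QP)

lemma gen_op_z_x: "Q * gen_op Z (gen_op X v) n - P * gen_op X (gen_op Z v) n = - gen_op Z v n"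
  by (simp add: \<xi>_pred algebra_simps QP)

lemma gen_op_y_z: "Q * gen_op Y (gen_op Z v) n - P * gen_op Z (gen_op Y v) n = - gen_op Z v n"
  by (simp add: \<eta>_pred \<gamma>_pred algebra_simps QP)

lemma gen_op_x_y:
  "gen_op X (gen_op Y v) n + Q\<^sup>2 * gen_op Z (gen_op Z v) n = gen_op Y (gen_op X v) n + P\<^sup>2 * gen_op Z (gen_op Z v) n"
proof -
  have "gen_op X (gen_op Y v) n + Q\<^sup>2 * gen_op Z (gen_op Z v) n - (gen_op Y (gen_op X v) n + P\<^sup>2 * gen_op Z (gen_op Z v) n)
    = (Q\<^sup>2 - P\<^sup>2) * (1 - \<gamma> n * (1 + (Q - P) * \<xi> n)) * v (n - 2)"
    by (simp add: pred_pred \<xi>_pred algebra_simps QP power2_eq_square)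
  then show ?thesis by (simp add: \<gamma>_inverse)
qed

lemma gen_op_sum:
  "gen_op X v n + gen_op Y v n + (Q - P) * (gen_op X (gen_op Y v) n + Q\<^sup>2 * gen_op Z (gen_op Z v) n) = 0"
proof -
  have "gen_op X v n + gen_op Y v n + (Q - P) * (gen_op X (gen_op Y v) n + Q\<^sup>2 * gen_op Z (gen_op Z v) n)
    = (\<xi> n + \<eta> n + (Q - P) * (\<xi> n * \<eta> n)) * v n
      + Q\<^sup>2 * (Q - P) * (1 - \<gamma> n * (1 + (Q - P) * \<xi> n)) * v (n - 2)"
    by (simp add: algebra_simps power2_eq_square)
  then show ?thesis by (simp add: \<gamma>_inverse \<xi>_\<eta>)
qed

end

section \<open>The action of the presented algebra\<close>

context unit_pair
begin

lemma gen_op_add: "gen_op g (\<lambda>n. v n + u n) = (\<lambda>n. gen_op g v n + gen_op g u n)"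
  by (cases g) (auto simp: algebra_simps)

lemma gen_op_scale: "gen_op g (\<lambda>n. s * v n) = (\<lambda>n. s * gen_op g v n)"
  by (cases g) (auto simp: algebra_simps)

lemma word_op_add: "foldr gen_op w (\<lambda>n. v n + u n) = (\<lambda>n. foldr gen_op w v n + foldr gen_op w u n)"
  by (induction w) (simp_all add: gen_op_add del: gen_op.simps)

lemma word_op_scale: "foldr gen_op w (\<lambda>n. s * v n) = (\<lambda>n. s * foldr gen_op w v n)"
  by (induction w) (simp_all add: gen_op_scale del: gen_op.simps)

definition act :: "(gen list \<Rightarrow>\<^sub>0 'r) \<Rightarrow> 'r seq \<Rightarrow> 'r seq" where
  "act f v n = (\<Sum>w\<in>Poly_Mapping.keys f. emb (Poly_Mapping.lookup f w) * foldr gen_op w v n)"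

lemma act_superset:
  assumes "finite A" "Poly_Mapping.keys f \<subseteq> A"
  shows "act f v n = (\<Sum>w\<in>A. emb (Poly_Mapping.lookup f w) * foldr gen_op w v n)"
  unfolding act_def using assms by (intro sum.mono_neutral_left) (auto simp: in_keys_iff)

lemma act_single: "act (Poly_Mapping.single w c) v n = emb c * foldr gen_op w v n"
  by (simp add: act_superset[of "{w}"])

lemma act_add: "act (f + g) v n = act f v n + act g v n"
proof -
  note [simp] = act_superset[of "Poly_Mapping.keys f \<union> Poly_Mapping.keys g"]
  show ?thesis using keys_add[of f g]
    by (simp add: lookup_add distrib_right sum.distrib)
qed

lemma act_0: "act 0 v n = 0"
  by (simp add: act_def)

lemma act_uminus: "act (- f) v n = - act f v n"
  using act_add[of f "- f" v n] by (simp add: act_0 eq_neg_iff_add_eq_0 add.commute)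

lemma act_diff: "act (f - g) v n = act f v n - act g v n"
  using act_add[of f "- g" v n] by (simp add: act_uminus)

lemma act_vec_add: "act f (\<lambda>n. v n + u n) n = act f v n + act f u n"
  by (simp add: act_def word_op_add distrib_left sum.distrib)

lemma act_vec_scale: "act f (\<lambda>n. s * v n) n = s * act f v n"
  by (simp add: act_def word_op_scale sum_distrib_left mult.left_commute)

lemma act_vec_0: "act f (\<lambda>n. 0) n = 0"
  using act_vec_scale[of f 0 "\<lambda>n. 0" n] by simp

lemma act_mult: "act (f * g) v n = act f (act g v) n"
proof (induction f arbitrary: n rule: poly_mapping_additive_induct)
  case (single w c)
  show ?case
  proof (induction g arbitrary: n rule: poly_mapping_additive_induct)
    case (single w' d)
    have "act (Poly_Mapping.single w' d) v = (\<lambda>n. emb d * foldr gen_op w' v n)"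
      by (rule ext) (rule act_single)
    then show ?case
      by (simp add: mult_single plus_list_def act_single word_op_scale mult_ac)
  next
    case (add f g)
    have "act (f + g) v = (\<lambda>n. act f v n + act g v n)" by (rule ext) (rule act_add)
    with add show ?case by (simp add: distrib_left act_add act_vec_add)
  qed
next
  case (add f g)
  then show ?case by (simp add: distrib_right act_add)
qed

lemma act_const: "act (const c) v n = emb c * v n"
  by (simp add: const_def act_single)

lemma act_var: "act (var g) v = gen_op g v"
  by (rule ext) (simp add: var_def act_single del: gen_op.simps)

lemmas act_simps = act_add act_uminus act_diff act_mult act_const act_var

lemma act_relator:
  assumes "f \<in> U_relators q" shows "act f v n = 0"
proof -
  have eqs: "act (f * g) v = act f (act g v)" for f g v by (rule ext) (rule act_mult)
  show ?thesis
    using assms unfolding U_relators_def Let_def unit_inv_q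
    apply (elim insertE emptyE)
          apply (simp_all only: act_simps eqs power2_eq_square emb_simps)
    subgoal using gen_op_x_theta[of v n] by (simp del: gen_op.simps)
    subgoal using gen_op_y_theta[of v n] by (simp del: gen_op.simps)
    subgoal using gen_op_theta_z[of v n] by (simp del: gen_op.simps)
    subgoal using gen_op_z_x[of v n] by (simp del: gen_op.simps)
    subgoal using gen_op_y_z[of v n] by (simp del: gen_op.simps)
    subgoal using gen_op_x_y[of v n] by (simp add: power2_eq_square del: gen_op.simps)
    subgoal using gen_op_sum[of v n] by (simp add: power2_eq_square del: gen_op.simps)
    done
qed

lemma a_inv_type_ring: "\<ominus>\<^bsub>type_ring\<^esub> f = - (f :: 'b::ring_1)"
  by (rule abelian_group.minus_equality[OF ring.is_abelian_group[OF ring_type_ring]]) simp_all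

text \<open>The elements acting as zero form a two-sided ideal, so the presented algebra acts.\<close>

lemma act_U_ideal:
  assumes "f \<in> U_ideal q" shows "act f v = (\<lambda>n. 0)"
proof -
  let ?K = "{f. \<forall>v. act f v = (\<lambda>n. 0)}"
  have "ideal ?K free_algebra"
  proof (rule idealI[OF ring_type_ring])
    show "subgroup ?K (add_monoid free_algebra)"
    proof (rule subgroup.intro)
      fix f assume "f \<in> ?K"
      then show "inv\<^bsub>add_monoid free_algebra\<^esub> f \<in> ?K"
        using a_inv_type_ring[of f] by (auto simp: a_inv_def act_uminus fun_eq_iff)
    qed (auto simp: fun_eq_iff act_add act_0)
  next
    fix f g :: "gen list \<Rightarrow>\<^sub>0 'r" assume "f \<in> ?K"
    then have f: "act f v = (\<lambda>n. 0)" for v by blast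
    show "g \<otimes>\<^bsub>free_algebra\<^esub> f \<in> ?K" "f \<otimes>\<^bsub>free_algebra\<^esub> g \<in> ?K"
      by (auto simp: fun_eq_iff act_mult f act_vec_0)
  qed
  then have "U_ideal q \<subseteq> ?K"
    unfolding U_ideal_def
    by (rule ring.genideal_minimal[OF ring_type_ring]) (auto simp: act_relator)
  with assms show ?thesis by blast
qed

end

section \<open>Leading coefficients and independence\<close>

context unit_pair
begin

text \<open>The last conjunct is the coefficient at the lowest exponent of \<open>z\<close> that can occur;
  degree 0 means that \<open>c\<close> does not occur. Multiplication by \<open>a\<close>, \<open>b\<close>, \<open>z\<close> changes these
  data in a controlled way, since the correction term in the operator of \<open>y\<close> raises the
  exponent of \<open>z\<close>.\<close>

definition leading :: "int \<Rightarrow> 'r fps \<Rightarrow> 'r seq \<Rightarrow> bool" where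
  "leading k t v \<longleftrightarrow> (\<forall>n<k. v n = 0) \<and> (\<forall>n. degree (v n) = 0) \<and> v k = [:t:]"

lemma degree_0_closed:
  fixes f g :: "'r fps poly"
  shows "degree f = 0 \<Longrightarrow> degree g = 0 \<Longrightarrow> degree (f + g) = 0"
    "degree f = 0 \<Longrightarrow> degree g = 0 \<Longrightarrow> degree (f - g) = 0"
    "degree f = 0 \<Longrightarrow> degree g = 0 \<Longrightarrow> degree (f * g) = 0"
    "degree f = 0 \<Longrightarrow> degree (- f) = 0"
    "degree (emb c) = 0" "degree (\<xi> n) = 0" "degree (\<eta> n) = 0"
  using degree_add_le_max[of f g] degree_diff_le_max[of f g] degree_mult_le[of f g]
  by (simp_all add: emb_def \<xi>_def \<eta>_def)

lemma degree_\<gamma>: "degree (\<gamma> n) = 0"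
  unfolding \<gamma>_def by (intro degree_0_closed) simp

lemma act_a: "act a v n = (\<eta> n - \<xi> n) * v n - Q * Q * (Q - P) * \<gamma> n * v (n - 2)"
  by (simp add: a_def act_simps algebra_simps)

lemma act_b: "act b v n = - (\<xi> n * \<eta> n) * v n + Q * Q * ((Q - P) * \<xi> n * \<gamma> n - 1) * v (n - 2)"
  by (simp add: b_def act_simps power2_eq_square algebra_simps)

lemma leading_a:
  assumes "leading k t v" shows "leading k ((eta k - xi k) * t) (act a v)"
  using assms unfolding leading_def act_a
  by (auto intro!: degree_0_closed degree_\<gamma> simp: \<xi>_def[of k] \<eta>_def[of k])

lemma leading_b:
  assumes "leading k t v" shows "leading k (- (xi k * eta k) * t) (act b v)"
  using assms unfolding leading_def act_b
  by (auto intro!: degree_0_closed degree_\<gamma> simp: \<xi>_def[of k] \<eta>_def[of k])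

lemma leading_z:
  assumes "leading k t v" shows "leading (k + 1) t (act z v)"
  using assms unfolding leading_def by (auto simp: act_var)

lemma act_power: "act (f ^ Suc k) v = act f (act (f ^ k) v)"
  by (rule ext) (simp add: act_mult)

lemma act_1: "act 1 v = v"
  using act_const[of 1 v] by (auto simp: const_simps(1))

lemma leading_a_power: "leading k t v \<Longrightarrow> leading k ((eta k - xi k) ^ d * t) (act (a ^ d) v)"
  by (induction d) (auto simp: act_1 act_power mult.assoc simp del: power_Suc intro: leading_a, simp add: mult.assoc leading_a)

lemma leading_b_power: "leading k t v \<Longrightarrow> leading k ((- (xi k * eta k)) ^ j * t) (act (b ^ j) v)"
proof (induction j)
  case (Suc j)
  then show ?case using leading_b[of k "(- (xi k * eta k)) ^ j * t"]
    unfolding act_power by (simp add: mult.assoc)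
qed (simp add: act_1)

lemma leading_z_power: "leading k t v \<Longrightarrow> leading (k + int n) t (act (z ^ n) v)"
proof (induction n)
  case (Suc n)
  then show ?case using leading_z[of "k + int n" t]
    unfolding act_power by (simp add: add_ac)
qed (simp add: act_1)

text \<open>The operator \<open>\<theta> = (c + y - q b) z\<^sup>-\<^sup>1\<close> has degree 1 in \<open>c\<close> with leading coefficient
  \<open>z\<^sup>-\<^sup>1\<close>, so the top coefficient in \<open>c\<close> only undergoes a shift.\<close>

lemma theta_degree:
  assumes "\<And>n. degree (v n) \<le> m"
  shows "degree (act th v n) \<le> Suc m" "coeff (act th v n) (Suc m) = coeff (v (n + 1)) m"
proof -
  define r where "r = (\<eta> n + Q * (\<xi> n * \<eta> n)) * v (n + 1) + Q * \<gamma> n * v (n - 1)"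
  have eq: "act th v n = pCons 0 (v (n + 1)) + r"
    by (simp add: act_var r_def \<tau>_def algebra_simps)
  have le: "degree (f * v k) \<le> m" if "degree f = 0" for f k
    using degree_mult_le[of f "v k"] assms[of k] that by simp
  have r: "degree r \<le> m"
    unfolding r_def by (intro degree_add_le le degree_0_closed degree_\<gamma>)
  show "degree (act th v n) \<le> Suc m"
    unfolding eq using r assms[of "n + 1"] degree_pCons_le[of 0 "v (n + 1)"] by (intro degree_add_le) auto
  show "coeff (act th v n) (Suc m) = coeff (v (n + 1)) m"
    unfolding eq using r by (simp add: coeff_eq_0)
qed

lemma theta_power_degree:
  assumes "\<And>n. degree (v n) = 0"
  shows "degree (act (th ^ m) v n) \<le> m \<and> coeff (act (th ^ m) v n) m = coeff (v (n + int m)) 0"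
proof (induction m arbitrary: n)
  case (Suc m)
  then show ?case
    using theta_degree[of "act (th ^ m) v" m n] unfolding act_power by (simp add: add_ac)
qed (simp add: act_1 assms)

text \<open>The unit element \<open>z\<^sup>0\<close> of the skew Laurent ring, to which the monomials are applied.\<close>

definition delta :: "'r seq" where "delta n = (if n = 0 then 1 else 0)"

definition "pbw_coeff M k e i = fps_nth (coeff (act (pbw_monomial q i) delta k) M) e"

lemma pbw_leading_fps:
  "(eta 0 - xi 0) ^ d * ((- (xi 0 * eta 0)) ^ j * 1)
    = fps_X ^ (d + 2 * j) * ((- (geom + 1)) ^ d * geom ^ j)"
proof -
  have "eta 0 - xi 0 = fps_X * - (geom + 1)" "- (xi 0 * eta 0) = fps_X ^ 2 * geom"
    by (simp_all add: xi_0 eta_0 algebra_simps power2_eq_square)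
  moreover have "(fps_X * - (geom + 1)) ^ d = fps_X ^ d * (- (geom + 1)) ^ d"
    by (rule power_mult_distrib)
  moreover have "(fps_X ^ 2 * geom) ^ j = fps_X ^ (2 * j) * geom ^ j"
    by (simp only: power_mult_distrib power_mult)
  ultimately show ?thesis
    by (simp only: power_add mult_1 mult_1_right mult_ac)
qed

text \<open>The monomial with exponents \<open>(m, n, d, j)\<close> has the leading term
  \<open>(- 2)\<^sup>d c\<^sup>m z\<^sup>n\<^sup>-\<^sup>m X\<^sup>e\<close> with \<open>e = d + 2 j\<close>: first the degree in \<open>c\<close> is
  maximal, then the exponent of \<open>z\<close> minimal, then the exponent of \<open>X\<close> minimal.
  Here \<open>pbw_coeff M k e\<close> reads off the coefficient at \<open>c\<^sup>M z\<^sup>k X\<^sup>e\<close>; the factor \<open>(- 2)\<^sup>d\<close> arises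
  because \<open>\<eta> - \<xi>\<close> starts with \<open>- 2 X\<close>, while \<open>- \<xi> \<eta>\<close> starts with \<open>X\<^sup>2\<close>.\<close>

lemma pbw_coeff:
  shows pbw_coeff_theta: "m < M \<Longrightarrow> pbw_coeff M k e (m, n, d, j) = 0"
    and pbw_coeff_z: "k + int m < int n \<Longrightarrow> pbw_coeff m k e (m, n, d, j) = 0"
    and pbw_coeff_ab: "e < d + 2 * j \<Longrightarrow> pbw_coeff m (int n - int m) e (m, n, d, j) = 0"
    and pbw_coeff_self: "pbw_coeff m (int n - int m) (d + 2 * j) (m, n, d, j) = (- 2) ^ d"
proof -
  define v where "v = act (z ^ n) (act (a ^ d) (act (b ^ j) delta))"
  have "leading 0 1 delta" by (simp add: leading_def delta_def)
  then have "leading (0 + int n) ((eta 0 - xi 0) ^ d * ((- (xi 0 * eta 0)) ^ j * 1)) v"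
    unfolding v_def by (intro leading_z_power leading_a_power leading_b_power)
  then have v: "\<And>k. k < int n \<Longrightarrow> v k = 0" "\<And>k. degree (v k) = 0"
    "v (int n) = [:fps_X ^ (d + 2 * j) * ((- (geom + 1)) ^ d * geom ^ j):]"
    unfolding pbw_leading_fps by (simp_all add: leading_def)
  have "act (pbw_monomial q (m, n, d, j)) delta k = act (th ^ m) v k" for k
  proof -
    have eqs: "act (f * g) v = act f (act g v)" for f g v by (rule ext) (rule act_mult)
    show ?thesis by (simp add: pbw_monomial_def v_def eqs a_def b_def)
  qed
  then have eq: "pbw_coeff M k e (m, n, d, j) = fps_nth (coeff (act (th ^ m) v k) M) e" for M k e
    by (simp add: pbw_coeff_def)
  note deg = theta_power_degree[of v m, OF v(2)]
  show "m < M \<Longrightarrow> pbw_coeff M k e (m, n, d, j) = 0"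
    using deg[of k] by (simp add: eq coeff_eq_0)
  show "k + int m < int n \<Longrightarrow> pbw_coeff m k e (m, n, d, j) = 0"
    using deg[of k] v(1) by (simp add: eq)
  have lead: "pbw_coeff m (int n - int m) e (m, n, d, j)
    = fps_nth (fps_X ^ (d + 2 * j) * ((- (geom + 1)) ^ d * geom ^ j)) e" for e
    using deg[of "int n - int m"] v(3) by (simp add: eq)
  show "e < d + 2 * j \<Longrightarrow> pbw_coeff m (int n - int m) e (m, n, d, j) = 0"
    unfolding lead by (simp only: fps_X_power_mult_nth if_True)
  have "fps_nth geom 0 = 1" by (simp add: geom_def)
  then have "fps_nth ((- (geom + 1)) ^ d * geom ^ j) 0 = (- 2) ^ d"
    by (simp add: fps_mult_nth_0 fps_nth_power_0)
  then show "pbw_coeff m (int n - int m) (d + 2 * j) (m, n, d, j) = (- 2) ^ d"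
    unfolding lead by (simp only: fps_X_power_mult_nth diff_self_eq_0 less_irrefl if_False)
qed

end

context unit_pair_with_half
begin

text \<open>As \<open>d\<close> is 0 or 1, the number \<open>d + 2 j\<close> determines \<open>d\<close> and \<open>j\<close>, so distinct
  monomials have distinct leading positions. Reading a vanishing combination at the extremal position
  among its nonzero coefficients isolates one coefficient, multiplied by the unit \<open>(- 2)\<^sup>d\<close>.\<close>

lemma pbw_monomials_independent:
  assumes "finite J" and J: "J \<subseteq> {(m, n, d, j). d \<in> {0, 1}}"
    and I: "(\<Sum>i\<in>J. const (c i) * pbw_monomial q i) \<in> U_ideal q"
  shows "\<forall>i\<in>J. c i = 0"
proof (rule ccontr)
  define K where "K = {i \<in> J. c i \<noteq> 0}"
  \<comment> \<open>The lexicographic order on these keys puts the extremal leading term first; the sign of the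
    exponent of \<open>\<theta>\<close> is reversed because the degree in \<open>c\<close> is to be maximal.\<close>
  define key where "key = (\<lambda>(m :: nat, n :: nat, d :: nat, j :: nat). (- int m, n, d + 2 * j))"
  assume "\<not> (\<forall>i\<in>J. c i = 0)"
  then have K: "finite K" "K \<noteq> {}" using \<open>finite J\<close> by (auto simp: K_def)
  then have "Min (key ` K) \<in> key ` K" by simp
  then obtain i where i: "i \<in> K" "Min (key ` K) = key i" by auto
  then have min: "key i \<le> key i'" if "i' \<in> K" for i'
    using K that by (metis Min_le finite_imageI imageI)
  obtain m n d j where [simp]: "i = (m, n, d, j)" by (cases i)
  let ?L = "pbw_coeff m (int n - int m) (d + 2 * j)"
  have other: "c i' * ?L i' = 0" if "i' \<in> J" "i' \<noteq> i" for i'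
  proof (cases "i' \<in> K")
    case True
    obtain m' n' d' j' where [simp]: "i' = (m', n', d', j')" by (cases i')
    have "d \<in> {0, 1}" "d' \<in> {0, 1}" using J i(1) that(1) by (auto simp: K_def)
    with that(2) have "(m', n', d' + 2 * j') \<noteq> (m, n, d + 2 * j)" by auto presburger+
    with min[OF True] have "m' < m \<or> m' = m \<and> (n < n' \<or> n' = n \<and> d + 2 * j < d' + 2 * j')"
      by (auto simp: key_def less_eq_prod_def less_prod_def)
    then consider "m' < m" | "m' = m" "n < n'" | "m' = m" "n' = n" "d + 2 * j < d' + 2 * j'"
      by blast
    then have "?L i' = 0"
      by cases (simp_all add: pbw_coeff)
    then show ?thesis by simp
  qed (use that in \<open>auto simp: K_def\<close>)
  have sum: "act (\<Sum>i\<in>S. const (c i) * pbw_monomial q i) v k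
    = (\<Sum>i\<in>S. emb (c i) * act (pbw_monomial q i) v k)" if "finite S" for S v k
    using that by (induction S) (simp_all add: act_0 act_add act_mult act_const)
  have "0 = fps_nth (coeff (act (\<Sum>i\<in>J. const (c i) * pbw_monomial q i) delta (int n - int m)) m) (d + 2 * j)"
    by (simp add: act_U_ideal[OF I])
  also have "\<dots> = (\<Sum>i'\<in>J. c i' * ?L i')"
    by (simp add: sum[OF \<open>finite J\<close>] coeff_sum coeff_emb_mult fps_sum_nth pbw_coeff_def)
  also have "\<dots> = c i * ?L i"
  proof -
    have "i \<in> J" using i(1) by (simp add: K_def)
    moreover have "(\<Sum>i'\<in>J - {i}. c i' * ?L i') = 0"
      by (rule sum.neutral) (use other in blast)
    ultimately show ?thesis using \<open>finite J\<close> by (simp only: sum.remove[of J i] add_0_right)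
  qed
  also have "\<dots> = c i * (- 2) ^ d"
    by (simp add: pbw_coeff_self)
  finally have "c i * (- 2) ^ d * (- h) ^ d = 0" by simp
  moreover have "(- 2) ^ d * (- h) ^ d = (1 :: 'r)"
    by (simp add: half flip: power_mult_distrib)
  ultimately have "c i = 0" by (simp add: mult.assoc)
  with i(1) show False by (simp add: K_def)
qed

end

section \<open>Passage to the quotient\<close>

lemma U_class_eq_zero_iff: "U_class q f = \<zero>\<^bsub>U q\<^esub> \<longleftrightarrow> f \<in> U_ideal q"
proof -
  have z: "\<zero>\<^bsub>U q\<^esub> = U_ideal q" by (simp add: U_sel FactRing_def)
  interpret ideal "U_ideal q" free_algebra by (rule ideal_U_ideal)
  show ?thesis
  proof
    assume "U_class q f = \<zero>\<^bsub>U q\<^esub>"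
    then show "f \<in> U_ideal q"
      using ideal.rcos_const_imp_mem[OF ideal_U_ideal, of f q] by (simp add: z U_class_def)
  next
    assume "f \<in> U_ideal q"
    then show "U_class q f = \<zero>\<^bsub>U q\<^esub>" by (simp add: z U_class_def a_rcos_const)
  qed
qed

lemma U_class_closed: "U_class q f \<in> carrier (U q)"
  using ring_hom_closed[OF U_class_hom] by simp

lemma U_class_simps:
  "U_class q (f + g) = U_class q f \<oplus>\<^bsub>U q\<^esub> U_class q g"
  "U_class q (f * g) = U_class q f \<otimes>\<^bsub>U q\<^esub> U_class q g"
  "U_class q 1 = \<one>\<^bsub>U q\<^esub>"
  "U_class q 0 = \<zero>\<^bsub>U q\<^esub>"
  using ring_hom_add[OF U_class_hom, of f g q] ring_hom_mult[OF U_class_hom, of f g q]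
    ring_hom_one[OF U_class_hom, of q] ring_hom_zero[OF U_class_hom ring_type_ring ring_U, of q]
  by simp_all

lemma U_class_power: "U_class q (f ^ k) = U_class q f [^]\<^bsub>U q\<^esub> k"
proof (induction k)
  case 0
  then show ?case by (simp add: U_class_simps)
next
  case (Suc k)
  then show ?case by (simp only: power_Suc2 U_class_simps nat_pow_Suc)
qed

lemma U_class_uminus: "U_class q (- f) = \<ominus>\<^bsub>U q\<^esub> U_class q f"
proof -
  interpret ring "U q" by (rule ring_U)
  have "U_class q (- f) \<oplus>\<^bsub>U q\<^esub> U_class q f = \<zero>\<^bsub>U q\<^esub>"
    by (simp flip: U_class_simps)
  then show ?thesis using minus_equality U_class_closed by metis
qed

lemma U_class_diff: "U_class q (f - g) = U_class q f \<ominus>\<^bsub>U q\<^esub> U_class q g"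
  using U_class_simps(1)[of q f "- g"] by (simp add: U_class_uminus a_minus_def)

lemma U_class_smult: "U_class q (const c * f) = c \<odot>\<^bsub>U q\<^esub> U_class q f"
  by (simp add: U_sel(6) U_class_simps U_sel(2))

lemma U_class_sum:
  assumes "finite J"
  shows "U_class q (\<Sum>i\<in>J. const (c i) * e i) = (\<Oplus>\<^bsub>U q\<^esub> i\<in>J. c i \<odot>\<^bsub>U q\<^esub> U_class q (e i))"
proof -
  interpret ring "U q" by (rule ring_U)
  show ?thesis using assms
  proof (induction J)
    case (insert i J)
    then show ?case
      by (subst finsum_insert) (auto simp: U_class_simps(1) U_class_smult[symmetric] U_class_closed)
  qed (simp add: U_class_simps)
qed

lemma U_class_pbw_monomial:
  "U_class q (pbw_monomial q (m, n, d, j))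
    = U_theta q [^]\<^bsub>U q\<^esub> m \<otimes>\<^bsub>U q\<^esub> U_z q [^]\<^bsub>U q\<^esub> n
        \<otimes>\<^bsub>U q\<^esub> U_a q [^]\<^bsub>U q\<^esub> d \<otimes>\<^bsub>U q\<^esub> U_b q [^]\<^bsub>U q\<^esub> j"
  by (simp add: pbw_monomial_def U_class_simps(2) U_class_power U_class_diff U_class_uminus
      U_sel(6) U_theta_def U_z_def U_a_def U_b_def U_x_def U_y_def)

theorem theorem4p2:
  fixes q :: "'r::comm_ring_1"
  assumes "(2::'r) dvd 1" and "q dvd 1"
  shows "is_module_basis type_ring (U q)
    {(m, n, d, p). d \<in> {0, 1}}
    (\<lambda>(m::nat, n::nat, d::nat, p::nat).
      U_theta q [^]\<^bsub>U q\<^esub> m \<otimes>\<^bsub>U q\<^esub> U_z q [^]\<^bsub>U q\<^esub> n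
        \<otimes>\<^bsub>U q\<^esub> U_a q [^]\<^bsub>U q\<^esub> d \<otimes>\<^bsub>U q\<^esub> U_b q [^]\<^bsub>U q\<^esub> p)"
    (is "is_module_basis _ _ ?B ?e")
proof -
  obtain p h where "q * p = 1" "2 * h = (1 :: 'r)"
    using assms by (metis dvdE)
  then interpret unit_pair_with_half q p h by unfold_locales
  have e: "?e = (\<lambda>i. U_class q (pbw_monomial q i))"
    by (auto simp: U_class_pbw_monomial)
  have "lin_independent_family type_ring (U q) ?B ?e"
    unfolding lin_independent_family_def e
    using pbw_monomials_independent by (auto simp flip: U_class_sum simp: U_class_eq_zero_iff)
  moreover have "spanning_family type_ring (U q) ?B ?e"
    unfolding spanning_family_def e
  proof
    interpret ring "U q" by (rule ring_U)
    fix v assume "v \<in> carrier (U q)"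
    then obtain f where v: "v = U_class q f"
      by (auto simp: U_sel FactRing_def A_RCOSETS_def' U_class_def)
    obtain J c where J: "finite J" "J \<subseteq> ?B"
        and "f - (\<Sum>i\<in>J. const (c i) * pbw_monomial q i) \<in> U_ideal q"
      using pbw_monomials_span by blast
    then have "U_class q (f - (\<Sum>i\<in>J. const (c i) * pbw_monomial q i)) = \<zero>\<^bsub>U q\<^esub>"
      by (simp only: U_class_eq_zero_iff)
    then have "U_class q f = U_class q (\<Sum>i\<in>J. const (c i) * pbw_monomial q i)"
      using U_class_simps(1)[of q "f - (\<Sum>i\<in>J. const (c i) * pbw_monomial q i)"
          "\<Sum>i\<in>J. const (c i) * pbw_monomial q i"] by (simp add: U_class_closed)
    with J show "\<exists>J c. finite J \<and> J \<subseteq> ?B \<and> c \<in> J \<rightarrow> carrier type_ring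
        \<and> v = (\<Oplus>\<^bsub>U q\<^esub>i\<in>J. c i \<odot>\<^bsub>U q\<^esub> U_class q (pbw_monomial q i))"
      unfolding v by (intro exI[of _ J] exI[of _ c]) (simp add: U_class_sum)
  qed
  ultimately show ?thesis
    unfolding is_module_basis_def by (auto simp: e U_class_closed)
qed

end
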